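(* Let $D$ be an associative division ring. Then for any $n\ge 1$ and any elements $x_1,\dots,x_n\in D$ there exists a polynomial $F(x)\in D[x]$ of degree $n$ such that $F(x_i)=0$ for every $i=1,\dots,n$.
   Context: $D[x]$ is the ring of polynomials $P(x)=a_nx^n+\dots+a_1x+a_0$ with $a_k\in D$, where the variable $x$ commutes with the coefficients; addition is coefficientwise, and the product of $\sum_i a_ix^i$ and $\sum_j b_jx^j$ is $\sum_k c_kx^k$ with $c_k=\sum_{i+j=k}a_ib_j$. The degree of $P(x)$ is $n$ if $a_n\ne 0$. The division ring $D$ need not be commutative. For $a\in D$, evaluation is with coefficients on the left: $P(a)=a_na^n+a_{n-1}a^{n-1}+\dots+a_1a+a_0$. *)

theory Defs
  imports Main "HOL-Computational_Algebra.Polynomial"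
begin

(* The library's poly and the ring structure on the type of polynomials require commutative
   coefficients; coeff and degree do not. Over a noncommutative ring, evaluation depends on the
   side on which the coefficients are written: here it is the left. *)
definition left_eval :: "'a::ring_1 poly \<Rightarrow> 'a \<Rightarrow> 'a" where
  "left_eval P a = (\<Sum>k\<le>degree P. coeff P k * a ^ k)"

end

theory Submission
  imports Defs
begin

text \<open>
  The polynomial is built one root at a time, by multiplying on the left by a linear factor.
  For \<open>G(X) = (X - b) F(X)\<close> with the coefficients kept on the left, evaluation gives
  \<open>G(y) = F(y) y - b F(y)\<close>. So every root of \<open>F\<close> stays a root of \<open>G\<close>, whatever \<open>b\<close> is. This is
  the reason for multiplying on the left: evaluation is not a ring homomorphism, and a factor
  placed on the right of \<open>F\<close> can destroy the old roots.

  A new point \<open>a\<close> becomes a root as soon as \<open>c a = b c\<close> with \<open>c = F(a)\<close>. If \<open>c \<noteq> 0\<close>, this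
  forces \<open>b\<close> to be the conjugate \<open>c a c\<^sup>-\<^sup>1\<close>, which is where division is used; if \<open>c = 0\<close>, any \<open>b\<close>
  works. Each step raises the degree by exactly one, and the construction starts from the
  constant polynomial 1.
\<close>

text \<open>Evaluation is additive only once its sums run over a common range, hence the free upper bound.\<close>

lemma left_eval_eq_sum:
  fixes P :: "'a::ring_1 poly"
  assumes "degree P \<le> N"
  shows "left_eval P a = (\<Sum>k\<le>N. coeff P k * a ^ k)"
  unfolding left_eval_def
  by (rule sum.mono_neutral_left) (use assms in \<open>auto simp: coeff_eq_0\<close>)

lemma left_eval_diff:
  fixes P Q :: "'a::ring_1 poly"
  shows "left_eval (P - Q) a = left_eval P a - left_eval Q a"
proof -
  define N where "N = max (degree P) (degree Q)"
  have "degree P \<le> N" "degree Q \<le> N" "degree (P - Q) \<le> N"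
    by (auto simp: N_def intro: degree_diff_le_max)
  then show ?thesis
    by (simp add: left_eval_eq_sum left_diff_distrib sum_subtractf)
qed

lemma left_eval_pCons:
  fixes P :: "'a::ring_1 poly"
  shows "left_eval (pCons c P) a = c + left_eval P a * a"
proof -
  have "left_eval (pCons c P) a = (\<Sum>k\<le>Suc (degree P). coeff (pCons c P) k * a ^ k)"
    by (rule left_eval_eq_sum) (rule degree_pCons_le)
  also have "\<dots> = c + (\<Sum>k\<le>degree P. coeff P k * a ^ Suc k)"
    by (subst sum.atMost_Suc_shift) simp
  also have "(\<Sum>k\<le>degree P. coeff P k * a ^ Suc k) = left_eval P a * a"
    by (simp add: left_eval_def sum_distrib_right mult.assoc power_commutes)
  finally show ?thesis .
qed

text \<open>
  Here \<^term>\<open>map_poly ((*) b) P\<close> is the left scalar multiple of \<^term>\<open>P\<close>: the scalar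
  multiplication \<^const>\<open>smult\<close> presupposes commuting coefficients.
\<close>

lemma left_eval_map_mult:
  fixes P :: "'a::ring_1 poly"
  shows "left_eval (map_poly ((*) b) P) a = b * left_eval P a"
proof -
  have "left_eval (map_poly ((*) b) P) a = (\<Sum>k\<le>degree P. coeff (map_poly ((*) b) P) k * a ^ k)"
    by (rule left_eval_eq_sum) (rule map_poly_degree_leq)
  then show ?thesis
    by (simp add: left_eval_def coeff_map_poly sum_distrib_left mult.assoc)
qed

text \<open>The product \<open>(X - b) P\<close>, with coefficients on the left.\<close>

definition linear_mult :: "'a::ring_1 \<Rightarrow> 'a poly \<Rightarrow> 'a poly" where
  "linear_mult b P = pCons 0 P - map_poly ((*) b) P"

lemma left_eval_linear_mult:
  "left_eval (linear_mult b P) a = left_eval P a * a - b * left_eval P a"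
  by (simp add: linear_mult_def left_eval_diff left_eval_pCons left_eval_map_mult)

lemma degree_linear_mult:
  fixes P :: "'a::ring_1 poly"
  assumes "P \<noteq> 0"
  shows "degree (linear_mult b P) = Suc (degree P)"
proof -
  have "degree (- map_poly ((*) b) P) < degree (pCons 0 P)"
    using map_poly_degree_leq[of "(*) b" P] assms by simp
  then have "degree (pCons 0 P + - map_poly ((*) b) P) = degree (pCons 0 P)"
    by (rule degree_add_eq_left)
  with assms show ?thesis
    by (simp add: linear_mult_def)
qed

text \<open>
  The right choice of the constant \<open>b\<close> is \<open>c a c\<^sup>-\<^sup>1\<close> with \<open>c = P(a)\<close>; the convention
  that 0 has inverse 0 makes the same formula cover the case \<open>c = 0\<close>.
\<close>

lemma left_eval_linear_mult_conjugate:
  fixes P :: "'a::division_ring poly" and a :: 'a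
  defines "c \<equiv> left_eval P a"
  shows "left_eval (linear_mult (c * a * inverse c) P) a = 0"
  by (cases "c = 0") (simp_all add: left_eval_linear_mult mult.assoc flip: c_def)

theorem theorem2:
  fixes n :: nat and x :: "nat \<Rightarrow> 'a::division_ring"
  assumes "n \<ge> 1"
  shows "\<exists>F :: 'a poly. degree F = n \<and> (\<forall>i\<in>{1..n}. left_eval F (x i) = 0)"
proof -
  \<comment> \<open>The zero polynomial also has degree 0, so it must be excluded for the degree to grow.\<close>
  have "\<exists>F :: 'a poly. F \<noteq> 0 \<and> degree F = n \<and> (\<forall>i\<in>{1..n}. left_eval F (x i) = 0)"
  proof (induction n)
    case 0
    show ?case by (rule exI[of _ "[:1:]"]) simp
  next
    case (Suc n)
    then obtain F :: "'a poly"
      where F: "F \<noteq> 0" "degree F = n" "\<forall>i\<in>{1..n}. left_eval F (x i) = 0"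
      by blast
    define c where "c = left_eval F (x (Suc n))"
    define G where "G = linear_mult (c * x (Suc n) * inverse c) F"
    have deg: "degree G = Suc n"
      using F by (simp add: G_def degree_linear_mult)
    have "left_eval G (x i) = 0" if "i \<in> {1..n}" for i
      using F(3) that by (simp add: G_def left_eval_linear_mult)
    moreover have "left_eval G (x (Suc n)) = 0"
      unfolding G_def c_def by (rule left_eval_linear_mult_conjugate)
    ultimately have "\<forall>i\<in>{1..Suc n}. left_eval G (x i) = 0"
      by (auto simp: atLeastAtMostSuc_conv)
    moreover have "G \<noteq> 0"
      using deg by auto
    ultimately show ?case
      using deg by blast
  qed
  then show ?thesis by blast
qed

end
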